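(* An infinite dimensional (associative unital) algebra $R$ over a field $\mathbb{F}$ is Arens regular if and only if $R$ contains a two-sided ideal $J$ of finite codimension such that $J^2=0$.
   Context: Let $R^*=\mathrm{Hom}_{\mathbb{F}}(R,\mathbb{F})$ and $R^{**}=\mathrm{Hom}_{\mathbb{F}}(R^*,\mathbb{F})$ be the algebraic dual and bidual. For $r,x\in R$, $\rho\in R^*$ put $(r\rho)(x)=\rho(xr)$ and $(\rho r)(x)=\rho(rx)$. For $s\in R^{**}$ define $\rho s,\,s\rho\in R^*$ by $(\rho s)(r)=s(r\rho)$ and $(s\rho)(r)=s(\rho r)$. The two Arens products on $R^{**}$ are $(s\cdot t)(\rho)=s(t\rho)$ and $(s\diamond t)(\rho)=t(\rho s)$ for $s,t\in R^{**}$, $\rho\in R^*$. $R$ is Arens regular if $s\cdot t=s\diamond t$ for all $s,t\in R^{**}$. *)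

theory Defs
  imports Complex_Main "HOL-Library.FuncSet"
begin

locale unital_algebra = vector_space scale
  for scale :: "'f::field \<Rightarrow> 'r::ring_1 \<Rightarrow> 'r" (infixr "*s" 75) +
  assumes scale_mult_left: "(a *s x) * y = a *s (x * y)"
    and scale_mult_right: "x * (a *s y) = a *s (x * y)"
begin

definition infinite_dimensional :: bool where
  "infinite_dimensional \<longleftrightarrow> \<not> (\<exists>B. finite_dimensional_vector_space scale B)"

definition dual :: "('r \<Rightarrow> 'f) set" where
  "dual = {\<rho>. Vector_Spaces.linear scale (*) \<rho>}"

text \<open>Elements of the bidual are linear maps on the set \<open>dual\<close> only; making them
  extensional (fixed to \<open>undefined\<close> outside \<open>dual\<close>) makes HOL equality the equality
  of maps \<open>dual \<rightarrow> 'f\<close>.\<close>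

definition bidual :: "(('r \<Rightarrow> 'f) \<Rightarrow> 'f) set" where
  "bidual = {s \<in> extensional dual.
     (\<forall>\<rho>\<in>dual. \<forall>\<sigma>\<in>dual. s (\<lambda>x. \<rho> x + \<sigma> x) = s \<rho> + s \<sigma>) \<and>
     (\<forall>a. \<forall>\<rho>\<in>dual. s (\<lambda>x. a * \<rho> x) = a * s \<rho>)}"

text \<open>\<open>lact\<close> and \<open>ract\<close> are \<open>r\<rho>\<close> and \<open>\<rho>r\<close>; \<open>lact2\<close> and \<open>ract2\<close> are \<open>s\<rho>\<close> and \<open>\<rho>s\<close>.\<close>

definition lact :: "'r \<Rightarrow> ('r \<Rightarrow> 'f) \<Rightarrow> 'r \<Rightarrow> 'f" where
  "lact r \<rho> = (\<lambda>x. \<rho> (x * r))"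

definition ract :: "('r \<Rightarrow> 'f) \<Rightarrow> 'r \<Rightarrow> 'r \<Rightarrow> 'f" where
  "ract \<rho> r = (\<lambda>x. \<rho> (r * x))"

definition lact2 :: "(('r \<Rightarrow> 'f) \<Rightarrow> 'f) \<Rightarrow> ('r \<Rightarrow> 'f) \<Rightarrow> 'r \<Rightarrow> 'f" where
  "lact2 s \<rho> = (\<lambda>r. s (ract \<rho> r))"

definition ract2 :: "('r \<Rightarrow> 'f) \<Rightarrow> (('r \<Rightarrow> 'f) \<Rightarrow> 'f) \<Rightarrow> 'r \<Rightarrow> 'f" where
  "ract2 \<rho> s = (\<lambda>r. s (lact r \<rho>))"

definition arens1 :: "(('r \<Rightarrow> 'f) \<Rightarrow> 'f) \<Rightarrow> (('r \<Rightarrow> 'f) \<Rightarrow> 'f) \<Rightarrow> ('r \<Rightarrow> 'f) \<Rightarrow> 'f" where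
  "arens1 s t = (\<lambda>\<rho>\<in>dual. s (lact2 t \<rho>))"

definition arens2 :: "(('r \<Rightarrow> 'f) \<Rightarrow> 'f) \<Rightarrow> (('r \<Rightarrow> 'f) \<Rightarrow> 'f) \<Rightarrow> ('r \<Rightarrow> 'f) \<Rightarrow> 'f" where
  "arens2 s t = (\<lambda>\<rho>\<in>dual. t (ract2 \<rho> s))"

definition arens_regular :: bool where
  "arens_regular \<longleftrightarrow> (\<forall>s\<in>bidual. \<forall>t\<in>bidual. arens1 s t = arens2 s t)"

definition two_sided_ideal :: "'r set \<Rightarrow> bool" where
  "two_sided_ideal J \<longleftrightarrow> subspace J \<and> (\<forall>r. \<forall>x\<in>J. r * x \<in> J \<and> x * r \<in> J)"

definition ideal_product :: "'r set \<Rightarrow> 'r set \<Rightarrow> 'r set" where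
  "ideal_product I J = span {x * y |x y. x \<in> I \<and> y \<in> J}"

definition quot_rel :: "'r set \<Rightarrow> ('r \<times> 'r) set" where
  "quot_rel J = {(x, y). x - y \<in> J}"

text \<open>The quotient \<open>R/J\<close> is finite dimensional: it is spanned by the classes of finitely
  many elements. The span of those classes is the image of \<open>span B\<close> under the (linear)
  projection \<open>x \<mapsto> quot_rel J `` {x}\<close>.\<close>

definition finite_codimension :: "'r set \<Rightarrow> bool" where
  "finite_codimension J \<longleftrightarrow>
     (\<exists>B. finite B \<and> (\<lambda>x. quot_rel J `` {x}) ` span B = UNIV // quot_rel J)"

end

end

theory Submission
  imports Defs "HOL-Library.Function_Algebras" "HOL-Library.Product_Plus"
begin

text \<open>If \<open>J\<close> has finite codimension and square zero, each form \<open>(x, y) \<mapsto> \<rho> (x y)\<close> has finite rank, so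
  the order of evaluation in the Arens products is irrelevant.

  Conversely, a form \<open>\<rho> (x y)\<close> that is unitriangular along two sequences has different iterated
  limits, so an Arens regular algebra admits none. Hence all these forms have finite rank, and every
  subspace of finite codimension contains a two-sided ideal of finite codimension. If no such ideal
  had square zero, one could build the two sequences step by step, with \<open>\<rho>\<close> obtained at the end by
  a compactness argument. Let \<open>N\<close> be the set of all \<open>x\<close> with \<open>x R\<close> of finite dimension. If \<open>N\<close> contains
  no subspace of finite codimension, pick the next \<open>x\<close> outside \<open>N\<close> and then \<open>y\<close> with \<open>x y\<close> avoiding
  everything already constrained. Otherwise, all \<open>x\<close> in \<open>N\<close> have annihilators of finite codimension,
  and the next \<open>x\<close> and \<open>y\<close> are taken in an ideal of finite codimension that is annihilated by the
  previous \<open>x\<close>'s and misses the span of the previous products.\<close>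

lemma vector_space_field: "vector_space ((*) :: 'a::field \<Rightarrow> 'a \<Rightarrow> 'a)"
  by unfold_locales (simp_all add: algebra_simps)

section \<open>Functionals and sets containing a subspace of finite codimension\<close>

text \<open>A locale of its own, because an abbreviation inside \<open>vector_space\<close> would be shadowed by its
  instance in the global interpretation \<open>real_vector\<close>.\<close>

locale functionals_on = vector_space scale
  for scale :: "'a::field \<Rightarrow> 'b::ab_group_add \<Rightarrow> 'b"
begin

abbreviation functional :: "('b \<Rightarrow> 'a) \<Rightarrow> bool" where
  "functional \<equiv> Vector_Spaces.linear scale (*)"

lemma functional_iff:
  "functional \<phi> \<longleftrightarrow> (\<forall>x y. \<phi> (x + y) = \<phi> x + \<phi> y) \<and> (\<forall>a x. \<phi> (scale a x) = a * \<phi> x)"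
  using vector_space_axioms vector_space_field by (auto simp: Vector_Spaces.linear_iff)

lemma functional_add: "functional \<phi> \<Longrightarrow> \<phi> (x + y) = \<phi> x + \<phi> y"
  and functional_scale: "functional \<phi> \<Longrightarrow> \<phi> (scale a x) = a * \<phi> x"
  by (simp_all add: functional_iff)

lemma functional_0: "functional \<phi> \<Longrightarrow> \<phi> 0 = 0"
  using functional_scale[of \<phi> 0 0] by simp

lemma functional_diff: "functional \<phi> \<Longrightarrow> \<phi> (x - y) = \<phi> x - \<phi> y"
  using functional_add[of \<phi> "x - y" y] by simp

lemma functional_sum: "functional \<phi> \<Longrightarrow> \<phi> (sum f A) = (\<Sum>i\<in>A. \<phi> (f i))"
  by (induction A rule: infinite_finite_induct) (auto simp: functional_0 functional_add)

lemma functional_zero: "functional (\<lambda>x. 0)"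
  by (simp add: functional_iff)

lemma functional_eq_0_on_span:
  assumes "functional \<phi>" "\<And>x. x \<in> S \<Longrightarrow> \<phi> x = 0" "x \<in> span S"
  shows "\<phi> x = 0"
  using assms(3)
  by (induction rule: span_induct_alt)
    (auto simp: assms functional_0 functional_add functional_scale)

text \<open>A basis of \<open>span S\<close> stays independent when \<open>v\<close> is added, so
  the values 0 on it and 1 at \<open>v\<close> extend linearly.\<close>

lemma separating_functional:
  assumes "v \<notin> span S"
  obtains \<phi> where "functional \<phi>" "\<And>x. x \<in> span S \<Longrightarrow> \<phi> x = 0" "\<phi> v = 1"
proof -
  interpret p: vector_space_pair scale "(*) :: 'a \<Rightarrow> 'a \<Rightarrow> 'a"
    using vector_space_axioms vector_space_field by (simp add: vector_space_pair_def)
  obtain B where B: "B \<subseteq> span S" "independent B" "span S \<subseteq> span B"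
    using maximal_independent_subset by blast
  have "span B = span S"
    using B span_minimal[OF B(1)] by auto
  then have v: "v \<notin> span B"
    using assms by simp
  then have "v \<notin> B"
    using span_base by blast
  have "independent (insert v B)"
    using B(2) v by (rule independent_insertI[rotated])
  from p.linear_independent_extend[OF this, of "\<lambda>x. if x = v then 1 else 0"]
  obtain \<phi> where \<phi>: "functional \<phi>" "\<forall>x\<in>insert v B. \<phi> x = (if x = v then 1 else 0)"
    by blast
  show thesis
  proof
    have "\<phi> b = 0" if "b \<in> B" for b
      using \<phi>(2) \<open>v \<notin> B\<close> that by auto
    then show "\<phi> x = 0" if "x \<in> span S" for x
      using functional_eq_0_on_span[OF \<phi>(1), of B x] that \<open>span B = span S\<close> by blast
  qed (use \<phi> in auto)
qed

text \<open>Finite codimension expressed by equations: intersections and preimages become operations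
  on finite sets of functionals, and \<open>W\<close> may be a set that is not known to be a
  subspace.\<close>

definition cofinite_dim :: "'b set \<Rightarrow> bool" where
  "cofinite_dim W \<longleftrightarrow>
     (\<exists>\<Phi>. finite \<Phi> \<and> (\<forall>\<phi>\<in>\<Phi>. functional \<phi>) \<and> {x. \<forall>\<phi>\<in>\<Phi>. \<phi> x = 0} \<subseteq> W)"

lemma cofinite_dimI:
  "finite \<Phi> \<Longrightarrow> (\<And>\<phi>. \<phi> \<in> \<Phi> \<Longrightarrow> functional \<phi>) \<Longrightarrow>
     (\<And>x. \<forall>\<phi>\<in>\<Phi>. \<phi> x = 0 \<Longrightarrow> x \<in> W) \<Longrightarrow> cofinite_dim W"
  unfolding cofinite_dim_def by (rule exI[of _ \<Phi>]) auto

lemma cofinite_dimE: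
  assumes "cofinite_dim W"
  obtains \<Phi> where "finite \<Phi>" "\<forall>\<phi>\<in>\<Phi>. functional \<phi>" "{x. \<forall>\<phi>\<in>\<Phi>. \<phi> x = 0} \<subseteq> W"
  using assms unfolding cofinite_dim_def by blast

lemma cofinite_dim_mono: "cofinite_dim V \<Longrightarrow> V \<subseteq> W \<Longrightarrow> cofinite_dim W"
  unfolding cofinite_dim_def by blast

lemma cofinite_dim_UNIV: "cofinite_dim UNIV"
  by (rule cofinite_dimI[of "{}"]) auto

lemma cofinite_dim_Int:
  assumes "cofinite_dim V" "cofinite_dim W"
  shows "cofinite_dim (V \<inter> W)"
proof -
  obtain \<Phi> where \<Phi>: "finite \<Phi>" "\<forall>\<phi>\<in>\<Phi>. functional \<phi>" "{x. \<forall>\<phi>\<in>\<Phi>. \<phi> x = 0} \<subseteq> V"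
    using assms(1) by (rule cofinite_dimE)
  obtain \<Psi> where \<Psi>: "finite \<Psi>" "\<forall>\<phi>\<in>\<Psi>. functional \<phi>" "{x. \<forall>\<phi>\<in>\<Psi>. \<phi> x = 0} \<subseteq> W"
    using assms(2) by (rule cofinite_dimE)
  show ?thesis
    by (rule cofinite_dimI[of "\<Phi> \<union> \<Psi>"]) (use \<Phi> \<Psi> in auto)
qed

lemma cofinite_dim_INT:
  "finite I \<Longrightarrow> (\<And>i. i \<in> I \<Longrightarrow> cofinite_dim (W i)) \<Longrightarrow> cofinite_dim (\<Inter>i\<in>I. W i)"
  by (induction I rule: finite_induct) (auto intro: cofinite_dim_Int cofinite_dim_UNIV)

lemma cofinite_dim_vimage:
  assumes "cofinite_dim W" "\<And>x y. f (x + y) = f x + f y" "\<And>a x. f (scale a x) = scale a (f x)"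
  shows "cofinite_dim (f -` W)"
proof -
  obtain \<Phi> where \<Phi>: "finite \<Phi>" "\<forall>\<phi>\<in>\<Phi>. functional \<phi>" "{x. \<forall>\<phi>\<in>\<Phi>. \<phi> x = 0} \<subseteq> W"
    using assms(1) by (rule cofinite_dimE)
  show ?thesis
    by (rule cofinite_dimI[of "(\<lambda>\<phi> x. \<phi> (f x)) ` \<Phi>"])
      (use \<Phi> assms(2,3) in \<open>auto simp: functional_iff\<close>)
qed

text \<open>Induction on \<open>B\<close>: a new vector outside the span brings a functional that
  reads off its coefficient, which is then 0 on the common kernel.\<close>

lemma cofinite_dim_avoids_span:
  assumes "finite B"
  obtains W where "cofinite_dim W" "W \<inter> span B = {0}"
proof -
  have "\<exists>\<Phi>. finite \<Phi> \<and> (\<forall>\<phi>\<in>\<Phi>. functional \<phi>) \<and> (\<forall>x\<in>span B. (\<forall>\<phi>\<in>\<Phi>. \<phi> x = 0) \<longrightarrow> x = 0)"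
    using assms
  proof (induction B rule: finite_induct)
    case empty
    show ?case
      by (rule exI[of _ "{}"]) simp
  next
    case (insert b B)
    then obtain \<Phi> where \<Phi>: "finite \<Phi>" "\<forall>\<phi>\<in>\<Phi>. functional \<phi>"
      "\<forall>x\<in>span B. (\<forall>\<phi>\<in>\<Phi>. \<phi> x = 0) \<longrightarrow> x = 0"
      by blast
    show ?case
    proof (cases "b \<in> span B")
      case True
      then show ?thesis
        using \<Phi> span_redundant by metis
    next
      case False
      then obtain \<psi> where \<psi>: "functional \<psi>" "\<And>x. x \<in> span B \<Longrightarrow> \<psi> x = 0" "\<psi> b = 1"
        using separating_functional by blast
      have "x = 0" if x: "x \<in> span (insert b B)" "\<forall>\<phi>\<in>insert \<psi> \<Phi>. \<phi> x = 0" for x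
      proof -
        obtain k where k: "x - scale k b \<in> span B"
          using x span_breakdown_eq by blast
        then have "k = 0"
          using \<psi>(2)[OF k] \<psi> x by (simp add: functional_diff functional_scale)
        then show ?thesis
          using k x \<Phi> by auto
      qed
      then show ?thesis
        using \<Phi> \<psi> by (intro exI[of _ "insert \<psi> \<Phi>"]) auto
    qed
  qed
  then obtain \<Phi> where \<Phi>: "finite \<Phi>" "\<forall>\<phi>\<in>\<Phi>. functional \<phi>"
    "\<forall>x\<in>span B. (\<forall>\<phi>\<in>\<Phi>. \<phi> x = 0) \<longrightarrow> x = 0"
    by blast
  show thesis
  proof
    show "cofinite_dim {x. \<forall>\<phi>\<in>\<Phi>. \<phi> x = 0}"
      using \<Phi> by (intro cofinite_dimI[of \<Phi>]) auto
    show "{x. \<forall>\<phi>\<in>\<Phi>. \<phi> x = 0} \<inter> span B = {0}"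
      using \<Phi> by (auto simp: functional_0 span_zero)
  qed
qed

text \<open>Induction on the functionals: one that does not vanish on the common kernel of the
  others costs one extra vector \<open>w\<close> from that kernel.\<close>

lemma cofinite_dim_complement:
  assumes "cofinite_dim W"
  obtains B where "finite B" "\<And>x. \<exists>b\<in>span B. x - b \<in> W"
proof -
  obtain \<Phi> where \<Phi>: "finite \<Phi>" "\<forall>\<phi>\<in>\<Phi>. functional \<phi>" "{x. \<forall>\<phi>\<in>\<Phi>. \<phi> x = 0} \<subseteq> W"
    using assms by (rule cofinite_dimE)
  from \<Phi>(1,2) have "\<exists>B. finite B \<and> (\<forall>x. \<exists>b\<in>span B. \<forall>\<phi>\<in>\<Phi>. \<phi> (x - b) = 0)"
  proof (induction \<Phi> rule: finite_induct)
    case empty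
    show ?case
      by (intro exI[of _ "{}"]) auto
  next
    case (insert \<psi> \<Phi>)
    then obtain B where B: "finite B" "\<And>x. \<exists>b\<in>span B. \<forall>\<phi>\<in>\<Phi>. \<phi> (x - b) = 0"
      by auto
    have \<psi>: "functional \<psi>" and \<Phi>: "\<And>\<phi>. \<phi> \<in> \<Phi> \<Longrightarrow> functional \<phi>"
      using insert by auto
    show ?case
    proof (cases "\<exists>w. (\<forall>\<phi>\<in>\<Phi>. \<phi> w = 0) \<and> \<psi> w \<noteq> 0")
      case False
      then show ?thesis
        using B by (metis insert_iff)
    next
      case True
      then obtain w where w: "\<And>\<phi>. \<phi> \<in> \<Phi> \<Longrightarrow> \<phi> w = 0" "\<psi> w \<noteq> 0"
        by blast
      have "\<exists>b\<in>span (insert w B). \<forall>\<phi>\<in>insert \<psi> \<Phi>. \<phi> (x - b) = 0" for x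
      proof -
        obtain b where b: "b \<in> span B" "\<forall>\<phi>\<in>\<Phi>. \<phi> (x - b) = 0"
          using B by blast
        \<comment> \<open>Chosen to make \<open>\<psi>\<close> vanish; the other functionals are 0
          at \<open>w\<close> and keep their values.\<close>
        define k where "k = \<psi> (x - b) / \<psi> w"
        have "b + scale k w \<in> span (insert w B)"
          using b(1) span_mono[of B "insert w B"] by (blast intro: span_add span_scale span_base)
        moreover have "\<phi> (x - (b + scale k w)) = 0" if "\<phi> \<in> insert \<psi> \<Phi>" for \<phi>
          using that \<psi> \<Phi> w b
          by (auto simp: functional_diff functional_add functional_scale k_def)
        ultimately show ?thesis
          by blast
      qed
      then show ?thesis
        using B(1) by (intro exI[of _ "insert w B"]) auto
    qed
  qed
  then obtain B where B: "finite B" "\<forall>x. \<exists>b\<in>span B. \<forall>\<phi>\<in>\<Phi>. \<phi> (x - b) = 0"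
    by (elim exE conjE)
  show thesis
    by (rule that[OF B(1)]) (use B(2) \<Phi>(3) in fast)
qed

text \<open>A basis \<open>A\<close> of \<open>J\<close> extends by vectors of \<open>B\<close> to a
  basis \<open>D\<close> of the whole space. The coordinates at \<open>D - A\<close> are
  functionals, and removing that part of \<open>x\<close> leaves a combination of
  \<open>A\<close>.\<close>

lemma finite_complement_coordinates:
  assumes "subspace J" "finite B" "\<And>x. \<exists>b\<in>span B. x - b \<in> J"
  obtains C c where "finite C" "\<And>b. functional (c b)" "\<And>x. x - (\<Sum>b\<in>C. scale (c b x) b) \<in> J"
proof -
  obtain A where A: "A \<subseteq> J" "independent A" "J \<subseteq> span A"
    using maximal_independent_subset by blast
  have sA: "span A \<subseteq> J"
    using A assms(1) span_minimal by blast
  obtain D where D: "A \<subseteq> D" "D \<subseteq> A \<union> B" "independent D" "A \<union> B \<subseteq> span D"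
    using maximal_independent_subset_extend[of A "A \<union> B"] A by auto
  have span_D: "x \<in> span D" for x
  proof -
    obtain b where b: "b \<in> span B" "x - b \<in> J"
      using assms(3) by blast
    have "b \<in> span D" "x - b \<in> span D"
      using b A(3) D(1,4) span_mono[of A D] span_minimal[of B "span D"] by auto
    then show ?thesis
      using span_add[of b D "x - b"] by simp
  qed
  show thesis
  proof
    show "finite (D - A)"
      using D assms(2) finite_subset[of "D - A" B] by auto
    show "functional (\<lambda>x. representation D x b)" for b
      using linear_representation[OF D(3)] span_D by auto
    show "x - (\<Sum>b\<in>D - A. scale (representation D x b) b) \<in> J" for x
    proof -
      let ?N = "{b. representation D x b \<noteq> 0}"
      have fin: "finite ?N"
        by (rule finite_representation)
      have ND: "?N \<subseteq> D"
        using representation_ne_zero by blast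
      have "x = (\<Sum>b\<in>?N. scale (representation D x b) b)"
        using sum_nonzero_representation_eq[OF D(3) span_D] by simp
      also have "\<dots> = (\<Sum>b\<in>?N \<inter> A. scale (representation D x b) b)
          + (\<Sum>b\<in>?N - A. scale (representation D x b) b)"
        using sum.Int_Diff[OF fin] by blast
      also have "(\<Sum>b\<in>?N - A. scale (representation D x b) b)
          = (\<Sum>b\<in>D - A. scale (representation D x b) b)"
        by (rule sum.mono_neutral_left) (use ND \<open>finite (D - A)\<close> in auto)
      finally have "x - (\<Sum>b\<in>D - A. scale (representation D x b) b)
          = (\<Sum>b\<in>?N \<inter> A. scale (representation D x b) b)"
        by (simp only: diff_eq_eq)
      also have "\<dots> \<in> span A"
        by (rule span_sum) (auto intro: span_scale span_base)
      finally show ?thesis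
        using sA by blast
    qed
  qed
qed

text \<open>A linear system for an unknown functional is solvable if the vector \<open>(0, 1)\<close> is not in the
  span of its equations, and membership in a span is witnessed by finitely many equations.\<close>

lemma functional_compactness:
  assumes "\<And>T'. finite T' \<Longrightarrow> T' \<subseteq> T \<Longrightarrow> \<exists>\<rho>. functional \<rho> \<and> (\<forall>(v, c)\<in>T'. \<rho> v = c)"
  shows "\<exists>\<rho>. functional \<rho> \<and> (\<forall>(v, c)\<in>T. \<rho> v = c)"
proof -
  \<comment> \<open>Scalar multiplication on the product with the field, where the equation
    \<open>\<rho> v = c\<close> becomes the vector \<open>(v, c)\<close>.\<close>
  define s where "s = (\<lambda>a (v, c). (scale a v, a * c :: 'a))"
  interpret P: functionals_on s
    by unfold_locales (auto simp: s_def algebra_simps)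
  have "(0, 1) \<notin> P.span T"
  proof
    assume "(0, 1) \<in> P.span T"
    then obtain T' r where T': "finite T'" "T' \<subseteq> T" "(0, 1) = (\<Sum>z\<in>T'. s (r z) z)"
      unfolding P.span_explicit by auto
    then obtain \<rho> where \<rho>: "functional \<rho>" "\<forall>(v, c)\<in>T'. \<rho> v = c"
      using assms by metis
    \<comment> \<open>This functional vanishes on the solved equations \<open>T'\<close> but is -1
      at \<open>(0, 1)\<close>.\<close>
    have lin: "P.functional (\<lambda>(v, c). \<rho> v - c)"
      using \<rho>(1) unfolding P.functional_iff functional_iff by (auto simp: s_def algebra_simps)
    have "(0, 1) \<in> P.span T'"
      using T'(3) by (metis (no_types, lifting) P.span_base P.span_scale P.span_sum)
    then have "(\<lambda>(v, c). \<rho> v - c) (0, 1) = 0"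
      by (rule P.functional_eq_0_on_span[OF lin, rotated]) (use \<rho>(2) in auto)
    then show False
      using \<rho>(1) by (simp add: functional_0)
  qed
  then obtain \<phi> where \<phi>: "P.functional \<phi>" "\<And>z. z \<in> P.span T \<Longrightarrow> \<phi> z = 0" "\<phi> (0, 1) = 1"
    using P.separating_functional by blast
  \<comment> \<open>For \<open>(v, c)\<close> in \<open>T\<close> the conditions on
    \<open>\<phi>\<close> give \<open>\<phi> (v, 0) + c = 0\<close>; hence the minus sign in the
    witness.\<close>
  show ?thesis
  proof (intro exI conjI ballI)
    have "(x + y, 0) = (x, 0) + (y, 0 :: 'a)" "(scale a x, 0) = s a (x, 0)" for a x y
      by (simp_all add: s_def)
    then show "functional (\<lambda>v. - \<phi> (v, 0))"
      using \<phi>(1) by (simp only: functional_iff P.functional_iff) simp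
    fix z assume "z \<in> T"
    then show "case z of (v, c) \<Rightarrow> - \<phi> (v, 0) = c"
    proof (cases z)
      case (Pair v c)
      have "(v, c) = (v, 0) + s c (0, 1)"
        by (simp add: s_def)
      then have "\<phi> (v, c) = \<phi> (v, 0) + c * \<phi> (0, 1)"
        using \<phi>(1) by (simp only: P.functional_add P.functional_scale)
      then show ?thesis
        using \<phi>(2)[OF P.span_base[OF \<open>z \<in> T\<close>]] \<phi>(3) Pair by (simp add: add_eq_0_iff)
    qed
  qed
qed

end

text \<open>Over an arbitrary field this replaces an ultrafilter limit: a functional on sequences
  that kills the eventually zero ones and is 1 on the constant sequence 1.\<close>

lemma limit_functional:
  obtains L :: "(nat \<Rightarrow> 'a::field) \<Rightarrow> 'a"
  where "\<And>f g. L (\<lambda>n. f n + g n) = L f + L g" "\<And>a f. L (\<lambda>n. a * f n) = a * L f"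
    "\<And>f c. eventually (\<lambda>n. f n = c) sequentially \<Longrightarrow> L f = c"
proof -
  interpret V: functionals_on "\<lambda>(a::'a) (f :: nat \<Rightarrow> 'a). (\<lambda>n. a * f n)"
    by unfold_locales (auto simp: algebra_simps fun_eq_iff)
  define Z where "Z = {f :: nat \<Rightarrow> 'a. eventually (\<lambda>n. f n = 0) sequentially}"
  have "V.subspace Z"
    unfolding V.subspace_def Z_def by (auto elim: eventually_elim2 eventually_mono)
  then have Z: "V.span Z = Z"
    by simp
  then have "(\<lambda>n. 1) \<notin> V.span Z"
    unfolding Z by (simp add: Z_def)
  then obtain L where L: "V.functional L" "\<And>f. f \<in> Z \<Longrightarrow> L f = 0" "L (\<lambda>n. 1) = 1"
    using V.separating_functional Z by metis
  show thesis
  proof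
    show "L (\<lambda>n. f n + g n) = L f + L g" for f g
      using V.functional_add[OF L(1), of f g] by (simp add: plus_fun_def)
    show scale: "L (\<lambda>n. a * f n) = a * L f" for a f
      using V.functional_scale[OF L(1)] .
    show "L f = c" if "eventually (\<lambda>n. f n = c) sequentially" for f c
    proof -
      have "f - (\<lambda>n. c * 1) \<in> Z"
        using that by (simp add: Z_def)
      then have "L f = L (\<lambda>n. c * 1)"
        using L(2) V.functional_diff[OF L(1), of f "\<lambda>n. c * 1"] by simp
      also have "\<dots> = c"
        using scale[of c "\<lambda>n. 1"] L(3) by simp
      finally show ?thesis .
    qed
  qed
qed

section \<open>Triangular sequences\<close>

text \<open>Greedy choice for a pairing fixed in advance, with \<open>X\<close> the set of earlier
  first entries.\<close>

lemma triangular_sequence: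
  fixes b :: "'x \<Rightarrow> 'y \<Rightarrow> 'f::zero_neq_one"
  assumes "\<And>X. finite X \<Longrightarrow> \<exists>x y. (\<forall>x'\<in>X. b x' y = 0) \<and> b x y = 1"
  obtains x :: "nat \<Rightarrow> 'x" and y :: "nat \<Rightarrow> 'y"
  where "\<And>i. b (x i) (y i) = 1" "\<And>i j. i < j \<Longrightarrow> b (x i) (y j) = 0"
proof -
  have "\<exists>f :: nat \<Rightarrow> 'x \<times> 'y. \<forall>n. (\<forall>i<n. b (fst (f i)) (snd (f n)) = 0) \<and> b (fst (f n)) (snd (f n)) = 1"
  proof (rule dependent_wellorder_choice)
    fix n :: nat and f :: "nat \<Rightarrow> 'x \<times> 'y"
    obtain x y where "\<forall>x'\<in>(\<lambda>i. fst (f i)) ` {..<n}. b x' y = 0" "b x y = 1"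
      using assms[of "(\<lambda>i. fst (f i)) ` {..<n}"] by auto
    then show "\<exists>r. (\<forall>i<n. b (fst (f i)) (snd r) = 0) \<and> b (fst r) (snd r) = 1"
      by (intro exI[of _ "(x, y)"]) auto
  qed auto
  then obtain f :: "nat \<Rightarrow> 'x \<times> 'y" where f:
    "\<And>n. (\<forall>i<n. b (fst (f i)) (snd (f n)) = 0) \<and> b (fst (f n)) (snd (f n)) = 1"
    by blast
  show thesis
    by (rule that[of "\<lambda>n. fst (f n)" "\<lambda>n. snd (f n)"]) (use f in auto)
qed

context functionals_on
begin

text \<open>The rows of a unitriangular matrix generate every row of the same shape.\<close>

lemma triangular_sequence_normalize:
  fixes b :: "'b \<Rightarrow> 'y \<Rightarrow> 'a" and x :: "nat \<Rightarrow> 'b" and y :: "nat \<Rightarrow> 'y"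
  assumes lin: "\<And>v. functional (\<lambda>u. b u v)"
    and diag: "\<And>i. b (x i) (y i) = 1"
    and upper: "\<And>i j. i < j \<Longrightarrow> b (x i) (y j) = 0"
  obtains x' where "\<And>n m. b (x' n) (y m) = (if m \<le> n then 1 else 0)"
proof -
  \<comment> \<open>Arbitrary entries \<open>c\<close> before column \<open>n\<close>, so that the
    induction goes through.\<close>
  have "\<exists>z. \<forall>m. b z (y m) = (if m < n then c m else 0)" for n and c :: "nat \<Rightarrow> 'a"
  proof (induction n arbitrary: c)
    case 0
    have "b 0 (y m) = 0" for m
      using functional_0[OF lin] .
    then show ?case
      by auto
  next
    case (Suc n)
    \<comment> \<open>Compensates in advance for the entries left of the diagonal in the row of
      \<open>x n\<close>, a multiple of which then sets column \<open>n\<close>.\<close>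
    obtain z where z: "\<And>m. b z (y m) = (if m < n then c m - c n * b (x n) (y m) else 0)"
      using Suc[of "\<lambda>m. c m - c n * b (x n) (y m)"] by auto
    have "b (z + scale (c n) (x n)) (y m) = (if m < Suc n then c m else 0)" for m
      using z[of m] diag[of n] upper[of n m]
      by (cases "m < n"; cases "m = n") (simp_all add: functional_add[OF lin] functional_scale[OF lin])
    then show ?case
      by blast
  qed
  then have "\<exists>z. \<forall>m. b z (y m) = (if m < Suc n then 1 else 0)" for n
    .
  then have "\<exists>z. \<forall>m. b z (y m) = (if m \<le> n then 1 else 0)" for n
    by (simp only: less_Suc_eq_le)
  then show thesis
    using that by metis
qed

text \<open>Here the functional is not known in advance. At each stage the new product lies outside
  the span of all products already constrained, so the current functional can be changed to take the
  value 1 there without disturbing them. Compactness merges the stages.\<close>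

lemma functional_triangular_sequence:
  fixes m :: "'x \<Rightarrow> 'y \<Rightarrow> 'b"
  assumes step: "\<And>X S \<rho>. finite X \<Longrightarrow> X \<subseteq> Q \<Longrightarrow> finite S \<Longrightarrow> functional \<rho> \<Longrightarrow>
      \<exists>x\<in>Q. \<exists>y. (\<forall>x'\<in>X. \<rho> (m x' y) = 0) \<and> m x y \<notin> span (S \<union> (\<lambda>x'. m x' y) ` X)"
  shows "\<exists>\<rho> x y. functional \<rho> \<and> (\<forall>i :: nat. \<rho> (m (x i) (y i)) = 1) \<and>
    (\<forall>i j. i < j \<longrightarrow> \<rho> (m (x i) (y j)) = 0)"
proof -
  define tri where "tri \<rho> f n \<longleftrightarrow> (\<forall>k<n. \<rho> (m (fst (f k)) (snd (f k))) = 1 \<and>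
      (\<forall>i<k. \<rho> (m (fst (f i)) (snd (f k))) = 0))" for \<rho> :: "'b \<Rightarrow> 'a" and f and n :: nat
  \<comment> \<open>The functional is quantified inside: each stage only has to admit some
    functional for the pairs so far and may replace the previous one.\<close>
  have "\<exists>f. \<forall>n. fst (f n) \<in> Q \<and> (\<exists>\<rho>. functional \<rho> \<and> tri \<rho> f n \<and>
      \<rho> (m (fst (f n)) (snd (f n))) = 1 \<and> (\<forall>i<n. \<rho> (m (fst (f i)) (snd (f n))) = 0))"
  proof (rule dependent_wellorder_choice)
    fix n :: nat and f :: "nat \<Rightarrow> 'x \<times> 'y"
    assume IH: "\<And>k. k < n \<Longrightarrow> fst (f k) \<in> Q \<and> (\<exists>\<rho>. functional \<rho> \<and> tri \<rho> f k \<and>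
      \<rho> (m (fst (f k)) (snd (f k))) = 1 \<and> (\<forall>i<k. \<rho> (m (fst (f i)) (snd (f k))) = 0))"
    have "\<exists>\<rho>. functional \<rho> \<and> tri \<rho> f n"
    proof (cases n)
      case 0
      then show ?thesis
        using functional_zero unfolding tri_def by blast
    next
      case (Suc n')
      then show ?thesis
        using IH[of n'] unfolding tri_def by (metis less_Suc_eq)
    qed
    then obtain \<rho> where \<rho>: "functional \<rho>" "tri \<rho> f n"
      by blast
    define X where "X = (\<lambda>i. fst (f i)) ` {..<n}"
    define S where "S = (\<lambda>(i, k). m (fst (f i)) (snd (f k))) ` ({..<n} \<times> {..<n})"
    obtain x y where xy: "x \<in> Q" "\<forall>x'\<in>X. \<rho> (m x' y) = 0"
      "m x y \<notin> span (S \<union> (\<lambda>x'. m x' y) ` X)"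
      using step[of X S \<rho>] \<rho> IH by (fastforce simp: X_def S_def)
    obtain \<phi> where \<phi>: "functional \<phi>" "\<And>v. v \<in> span (S \<union> (\<lambda>x'. m x' y) ` X) \<Longrightarrow> \<phi> v = 0"
      "\<phi> (m x y) = 1"
      using separating_functional[OF xy(3)] by blast
    \<comment> \<open>\<open>\<phi>\<close> vanishes on all earlier products and on those of earlier
      first entries with \<open>y\<close>, so only the value at \<open>m x y\<close> needs
      adjusting.\<close>
    define \<rho>' where "\<rho>' v = \<rho> v + (1 - \<rho> (m x y)) * \<phi> v" for v
    have "functional \<rho>'"
      using \<rho>(1) \<phi>(1) by (simp add: functional_iff \<rho>'_def algebra_simps)
    moreover have eq: "\<rho>' v = \<rho> v" if "v \<in> S \<union> (\<lambda>x'. m x' y) ` X" for v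
      using \<phi>(2)[OF span_base[OF that]] by (simp add: \<rho>'_def)
    have "\<rho>' (m (fst (f i)) (snd (f k))) = \<rho> (m (fst (f i)) (snd (f k)))" if "i < n" "k < n" for i k
      by (rule eq) (use that in \<open>force simp: S_def\<close>)
    then have "tri \<rho>' f n"
      using \<rho>(2) unfolding tri_def by auto
    moreover have "\<rho>' (m x y) = 1"
      by (simp add: \<rho>'_def \<phi>)
    moreover have "\<rho>' (m (fst (f i)) y) = 0" if "i < n" for i
      using eq[of "m (fst (f i)) y"] xy(2) that by (auto simp: X_def)
    ultimately show "\<exists>r. fst r \<in> Q \<and> (\<exists>\<rho>. functional \<rho> \<and> tri \<rho> f n \<and>
      \<rho> (m (fst r) (snd r)) = 1 \<and> (\<forall>i<n. \<rho> (m (fst (f i)) (snd r)) = 0))"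
      using xy(1) by (intro exI[of _ "(x, y)"]) auto
  qed (simp add: tri_def)
  then have "\<exists>f. \<forall>n. \<exists>\<rho>. functional \<rho> \<and> tri \<rho> f n"
    by (rule ex_forward) blast
  then obtain f where f: "\<forall>n. \<exists>\<rho>. functional \<rho> \<and> tri \<rho> f n"
    by (rule exE)
  \<comment> \<open>The equations on and above the diagonal; entries below it stay free.\<close>
  define e where "e = (\<lambda>(i, k). (m (fst (f i)) (snd (f k)), if i = k then 1 else 0 :: 'a))"
  have "\<exists>\<rho>. functional \<rho> \<and> (\<forall>(v, c)\<in>e ` {(i, k). i \<le> k}. \<rho> v = c)"
  proof (rule functional_compactness)
    fix T' assume "finite T'" "T' \<subseteq> e ` {(i, k). i \<le> k}"
    then obtain C where C: "C \<subseteq> {(i, k). i \<le> k}" "finite C" "T' = e ` C"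
      by (meson finite_subset_image)
    \<comment> \<open>Bounding the columns is enough, since \<open>i \<le> k\<close> bounds the rows
      too.\<close>
    then obtain N where N: "\<And>i k. (i, k) \<in> C \<Longrightarrow> k < N"
      using finite_nat_set_iff_bounded[of "snd ` C"] by force
    obtain \<rho> where \<rho>: "functional \<rho>" "tri \<rho> f N"
      using f[rule_format, of N] by (elim exE conjE)
    have "\<rho> v = c" if vc: "(v, c) \<in> T'" for v c
    proof -
      obtain i k where ik: "(i, k) \<in> C" "(v, c) = e (i, k)"
        using vc C(3) by auto
      then have "i \<le> k" "k < N"
        using C(1) N by auto
      then show ?thesis
        using \<rho>(2) ik(2) by (cases "i = k") (auto simp: tri_def e_def)
    qed
    with \<rho>(1) show "\<exists>\<rho>. functional \<rho> \<and> (\<forall>(v, c)\<in>T'. \<rho> v = c)"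
      by (intro exI[of _ \<rho>]) auto
  qed
  then obtain \<rho> where \<rho>: "functional \<rho>" "\<forall>(v, c)\<in>e ` {(i, k). i \<le> k}. \<rho> v = c"
    by (elim exE conjE)
  have "\<rho> (m (fst (f i)) (snd (f j))) = (if i = j then 1 else 0)" if "i \<le> j" for i j
    using \<rho>(2) that by (auto simp: e_def)
  with \<rho>(1) show ?thesis
    by (intro exI[of _ \<rho>] exI[of _ "\<lambda>i. fst (f i)"] exI[of _ "\<lambda>i. snd (f i)"]) simp
qed

end

section \<open>Arens regular algebras\<close>

sublocale unital_algebra \<subseteq> functionals_on ..

context unital_algebra
begin

section \<open>From Arens regularity to a square-zero ideal\<close>

lemma dual_iff: "\<rho> \<in> dual \<longleftrightarrow> functional \<rho>"
  by (simp add: dual_def)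

lemma lact_dual: "\<rho> \<in> dual \<Longrightarrow> lact r \<rho> \<in> dual"
  by (simp add: dual_iff functional_iff lact_def scale_mult_left distrib_right)

lemma ract_dual: "\<rho> \<in> dual \<Longrightarrow> ract \<rho> r \<in> dual"
  by (simp add: dual_iff functional_iff ract_def scale_mult_right distrib_left)

text \<open>Generalized limits along \<open>x\<close> and \<open>y\<close> are elements of the
  bidual, and their two Arens products at \<open>\<rho>\<close> are the two iterated limits.\<close>

lemma arens_regular_iterated_limits:
  assumes "arens_regular" "\<rho> \<in> dual"
    and "\<And>n. \<forall>\<^sub>F m in sequentially. \<rho> (x n * y m) = a"
    and "\<And>m. \<forall>\<^sub>F n in sequentially. \<rho> (x n * y m) = c"
  shows "a = c"
proof -
  obtain L :: "(nat \<Rightarrow> 'f) \<Rightarrow> 'f"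
    where L: "\<And>f g. L (\<lambda>n. f n + g n) = L f + L g" "\<And>a f. L (\<lambda>n. a * f n) = a * L f"
      "\<And>f c. eventually (\<lambda>n. f n = c) sequentially \<Longrightarrow> L f = c"
    using limit_functional by blast
  define lim_on where "lim_on z = (\<lambda>\<sigma>\<in>dual. L (\<lambda>n. \<sigma> (z n)))" for z
  have dual_add: "(\<lambda>x. \<sigma> x + \<tau> x) \<in> dual" and dual_scale: "(\<lambda>x. a * \<sigma> x) \<in> dual"
    if "\<sigma> \<in> dual" "\<tau> \<in> dual" for \<sigma> \<tau> a
    using that by (simp_all add: dual_iff functional_iff algebra_simps)
  have lim_on: "lim_on z \<in> bidual" for z
    using dual_add dual_scale by (auto simp: bidual_def lim_on_def L)
  have lim_on_dual: "lim_on z \<sigma> = L (\<lambda>n. \<sigma> (z n))" if "\<sigma> \<in> dual" for z \<sigma>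
    using that by (simp add: lim_on_def)
  have lact2: "lact2 (lim_on y) \<rho> = (\<lambda>r. L (\<lambda>m. \<rho> (r * y m)))"
    unfolding lact2_def lim_on_def using ract_dual[OF assms(2)] by (simp add: ract_def)
  have ract2: "ract2 \<rho> (lim_on x) = (\<lambda>r. L (\<lambda>n. \<rho> (x n * r)))"
    unfolding ract2_def lim_on_def using lact_dual[OF assms(2)] by (simp add: lact_def)
  have "lact2 (lim_on y) \<rho> \<in> dual" "ract2 \<rho> (lim_on x) \<in> dual"
    using assms(2) unfolding lact2 ract2
    by (simp_all add: dual_iff functional_iff distrib_left distrib_right scale_mult_left
        scale_mult_right L)
  \<comment> \<open>The limit along \<open>y\<close> is the inner one in \<open>arens1\<close> and
    the outer one in \<open>arens2\<close>.\<close>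
  then have "arens1 (lim_on x) (lim_on y) \<rho> = L (\<lambda>n. L (\<lambda>m. \<rho> (x n * y m)))"
    "arens2 (lim_on x) (lim_on y) \<rho> = L (\<lambda>m. L (\<lambda>n. \<rho> (x n * y m)))"
    using assms(2) by (simp_all add: arens1_def arens2_def lim_on_dual flip: lact2 ract2)
      (simp_all add: lact2 ract2)
  moreover have "arens1 (lim_on x) (lim_on y) \<rho> = arens2 (lim_on x) (lim_on y) \<rho>"
    using assms(1) lim_on unfolding arens_regular_def by metis
  moreover have "L (\<lambda>n. L (\<lambda>m. \<rho> (x n * y m))) = a"
    using L(3)[OF assms(3)] by (intro L(3)) simp
  moreover have "L (\<lambda>m. L (\<lambda>n. \<rho> (x n * y m))) = c"
    using L(3)[OF assms(4)] by (intro L(3)) simp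
  ultimately show ?thesis
    by simp
qed

text \<open>After normalization the matrix is 1 on and below the diagonal and 0 above it, so its
  rows tend to 0 and its columns to 1. Both orders of multiplication are covered because only the
  first argument of \<open>m\<close> is normalized.\<close>

lemma arens_regular_no_triangular_sequence:
  assumes "arens_regular" "\<rho> \<in> dual" and m: "m = (*) \<or> m = (\<lambda>u v. v * u)"
    and diag: "\<And>i. \<rho> (m (x i) (y i)) = 1"
    and upper: "\<And>i j :: nat. i < j \<Longrightarrow> \<rho> (m (x i) (y j)) = 0"
  shows False
proof -
  have "functional (\<lambda>u. \<rho> (m u v))" for v
    using m assms(2)
    by (auto simp: dual_iff functional_iff distrib_left distrib_right scale_mult_left scale_mult_right)
  then obtain x' where x': "\<And>n k. \<rho> (m (x' n) (y k)) = (if k \<le> n then 1 else 0)"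
    using triangular_sequence_normalize[of "\<lambda>u v. \<rho> (m u v)" x y] diag upper by metis
  have ev0: "\<forall>\<^sub>F k in sequentially. \<rho> (m (x' n) (y k)) = 0" for n
    using eventually_gt_at_top[of n] by eventually_elim (simp add: x')
  have ev1: "\<forall>\<^sub>F n in sequentially. \<rho> (m (x' n) (y k)) = 1" for k
    using eventually_ge_at_top[of k] by eventually_elim (simp add: x')
  from m show False
  proof
    assume "m = (*)"
    then show False
      using arens_regular_iterated_limits[OF assms(1,2), of x' y 0 1] ev0 ev1 by simp
  next
    \<comment> \<open>Now \<open>y\<close> supplies the left factors, so the two limits trade
      places.\<close>
    assume "m = (\<lambda>u v. v * u)"
    then show False
      using arens_regular_iterated_limits[OF assms(1,2), of y x' 1 0] ev0 ev1 by simp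
  qed
qed

text \<open>Finite rank of the form. Otherwise, for each finite \<open>X\<close>, some
  \<open>y\<close> is annihilated by \<open>X\<close> under the form but not by every
  \<open>x\<close>, which yields a triangular sequence.\<close>

lemma arens_regular_right_kernel:
  assumes "arens_regular" "\<rho> \<in> dual"
  shows "cofinite_dim {y. \<forall>x. \<rho> (x * y) = 0}"
proof (rule ccontr)
  assume not: "\<not> ?thesis"
  have "\<exists>x y. (\<forall>x'\<in>X. \<rho> (x' * y) = 0) \<and> \<rho> (x * y) = 1" if X: "finite X" for X
  proof -
    have "\<not> {y. \<forall>x'\<in>X. \<rho> (x' * y) = 0} \<subseteq> {y. \<forall>x. \<rho> (x * y) = 0}"
    proof
      assume "{y. \<forall>x'\<in>X. \<rho> (x' * y) = 0} \<subseteq> {y. \<forall>x. \<rho> (x * y) = 0}"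
      then have "cofinite_dim {y. \<forall>x. \<rho> (x * y) = 0}"
        using X ract_dual[OF assms(2)]
        by (intro cofinite_dimI[of "ract \<rho> ` X"]) (auto simp: dual_iff ract_def)
      with not show False ..
    qed
    then obtain x y where xy: "\<forall>x'\<in>X. \<rho> (x' * y) = 0" "\<rho> (x * y) \<noteq> 0"
      by blast
    have "\<rho> (scale (1 / \<rho> (x * y)) x * y) = 1"
      using assms(2) xy(2) by (simp add: scale_mult_left functional_scale dual_iff)
    with xy(1) show ?thesis
      by blast
  qed
  then obtain x y where "\<And>i. \<rho> (x i * y i) = 1" "\<And>i j :: nat. i < j \<Longrightarrow> \<rho> (x i * y j) = 0"
    using triangular_sequence[of "\<lambda>x y. \<rho> (x * y)"] by blast
  then show False
    using arens_regular_no_triangular_sequence[OF assms, of "(*)" x y] by blast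
qed

text \<open>The common right kernel \<open>L\<close> of the forms is a left ideal of finite
  codimension. The annihilator \<open>K\<close> of the finite-dimensional left module
  \<open>R/L\<close> is a two-sided ideal; it has finite codimension because membership need only be
  tested on a finite complement of \<open>L\<close>.\<close>

lemma arens_regular_ideal_within:
  assumes "arens_regular" "cofinite_dim W"
  obtains K where "two_sided_ideal K" "cofinite_dim K" "K \<subseteq> W"
proof -
  obtain \<Phi> where \<Phi>: "finite \<Phi>" "\<forall>\<phi>\<in>\<Phi>. functional \<phi>" "{x. \<forall>\<phi>\<in>\<Phi>. \<phi> x = 0} \<subseteq> W"
    using assms(2) by (rule cofinite_dimE)
  define L where "L = (\<Inter>\<phi>\<in>\<Phi>. {y. \<forall>x. \<phi> (x * y) = 0})"
  define K where "K = {r. \<forall>y. r * y \<in> L}"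
  have L: "cofinite_dim L"
    unfolding L_def using \<Phi> assms(1)
    by (intro cofinite_dim_INT arens_regular_right_kernel) (auto simp: dual_iff)
  have L_sub: "subspace L"
    unfolding L_def using \<Phi>(2)
    by (intro subspace_Int) (simp add: subspace_def functional_0 functional_add functional_scale
        distrib_left scale_mult_right)
  have L_left: "r * y \<in> L" if "y \<in> L" for r y
    using that by (auto simp: L_def simp flip: mult.assoc)
  obtain B where B: "finite B" "\<And>x. \<exists>b\<in>span B. x - b \<in> L"
    using cofinite_dim_complement[OF L] by blast
  have "(\<Inter>b\<in>B. (\<lambda>r. r * b) -` L) \<subseteq> K"
  proof
    fix r assume r: "r \<in> (\<Inter>b\<in>B. (\<lambda>r. r * b) -` L)"
    have span: "r * b \<in> L" if "b \<in> span B" for b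
      using that
    proof (induction rule: span_induct_alt)
      case base
      then show ?case
        using L_sub by (simp add: subspace_0)
    next
      case (step c b v)
      then show ?case
        using r L_sub by (auto simp: distrib_left scale_mult_right intro!: subspace_add subspace_scale)
    qed
    have "r * y \<in> L" for y
    proof -
      obtain b where "b \<in> span B" "y - b \<in> L"
        using B(2) by blast
      then have "r * b + r * (y - b) \<in> L"
        using span L_left L_sub subspace_add by blast
      then show ?thesis
        by (simp flip: distrib_left)
    qed
    then show "r \<in> K"
      by (simp add: K_def)
  qed
  moreover have "cofinite_dim (\<Inter>b\<in>B. (\<lambda>r. r * b) -` L)"
    using B(1) L by (intro cofinite_dim_INT cofinite_dim_vimage) (auto simp: distrib_right scale_mult_left)
  ultimately have "cofinite_dim K"
    using cofinite_dim_mono by blast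
  moreover have "two_sided_ideal K"
    using L_sub L_left by (auto simp: two_sided_ideal_def K_def subspace_def distrib_right
        scale_mult_left mult.assoc)
  moreover have "K \<subseteq> W"
  proof
    fix r assume "r \<in> K"
    \<comment> \<open>The inner 1 gives \<open>r \<in> L\<close>, the outer 1 evaluates the forms at
      \<open>r\<close>.\<close>
    then have "1 * (r * 1) \<in> {x. \<forall>\<phi>\<in>\<Phi>. \<phi> x = 0}"
      unfolding K_def L_def by blast
    then show "r \<in> W"
      using \<Phi>(3) by auto
  qed
  ultimately show thesis
    using that by blast
qed

lemma arens_regular_square_zero_ideal:
  assumes "arens_regular"
  shows "\<exists>J. two_sided_ideal J \<and> cofinite_dim J \<and> (\<forall>x\<in>J. \<forall>y\<in>J. x * y = 0)"
proof (rule ccontr)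
  assume "\<not> ?thesis"
  then have nonzero: "\<exists>x\<in>J. \<exists>y\<in>J. x * y \<noteq> 0" if "two_sided_ideal J" "cofinite_dim J" for J
    using that by blast
  define N where "N = {x. \<exists>F. finite F \<and> (\<forall>y. x * y \<in> span F)}"
  show False
  proof (cases "cofinite_dim N")
    case False
    \<comment> \<open>The left factor \<open>v\<close> is picked first, outside \<open>N\<close> and
      subject to the conditions from earlier right factors. Its products span an
      infinite-dimensional space, so some \<open>u\<close> escapes the finite span. The reversed
      multiplication makes \<open>X\<close> collect the right factors.\<close>
    have "\<exists>\<rho> u v. functional \<rho> \<and> (\<forall>i :: nat. \<rho> (v i * u i) = 1) \<and>
        (\<forall>i j. i < j \<longrightarrow> \<rho> (v j * u i) = 0)"
    proof (rule functional_triangular_sequence[where Q = UNIV and m = "\<lambda>u v. v * u"])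
      show "\<exists>u\<in>UNIV. \<exists>v. (\<forall>u'\<in>X. \<rho> (v * u') = 0) \<and> v * u \<notin> span (S \<union> (\<lambda>u'. v * u') ` X)"
        if "finite X" "X \<subseteq> UNIV" "finite S" "functional \<rho>" for X S :: "'r set" and \<rho>
      proof -
        have "\<not> {v. \<forall>u'\<in>X. \<rho> (v * u') = 0} \<subseteq> N"
        proof
          assume "{v. \<forall>u'\<in>X. \<rho> (v * u') = 0} \<subseteq> N"
          then have "cofinite_dim N"
            using that lact_dual[of \<rho>]
            by (intro cofinite_dimI[of "(\<lambda>u. lact u \<rho>) ` X"]) (auto simp: dual_iff lact_def)
          with False show False ..
        qed
        then obtain v where v: "\<forall>u'\<in>X. \<rho> (v * u') = 0" "v \<notin> N"
          by blast
        have "finite (S \<union> (\<lambda>u'. v * u') ` X)"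
          using that by simp
        then obtain u where "v * u \<notin> span (S \<union> (\<lambda>u'. v * u') ` X)"
          using v(2) unfolding N_def by blast
        with v(1) show ?thesis
          by blast
      qed
    qed
    then obtain \<rho> u v where \<rho>: "functional \<rho>" "\<forall>i :: nat. \<rho> (v i * u i) = 1"
      "\<forall>i j. i < j \<longrightarrow> \<rho> (v j * u i) = 0"
      by (elim exE conjE)
    show False
    proof (rule arens_regular_no_triangular_sequence[OF assms, where \<rho> = \<rho> and x = u and y = v
            and m = "\<lambda>u v. v * u"])
      show "\<rho> \<in> dual"
        using \<rho>(1) by (simp only: dual_iff)
      show "\<rho> (v i * u i) = 1" for i
        using \<rho>(2) by (rule spec)
      show "\<rho> (v j * u i) = 0" if "i < j" for i j
        using \<rho>(3) that by iprover
    qed (rule disjI2, rule refl)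
  next
    case True
    have "\<exists>\<rho> x y. functional \<rho> \<and> (\<forall>i :: nat. \<rho> (x i * y i) = 1) \<and>
        (\<forall>i j. i < j \<longrightarrow> \<rho> (x i * y j) = 0)"
    proof (rule functional_triangular_sequence[where Q = N and m = "(*)"])
      show "\<exists>x\<in>N. \<exists>y. (\<forall>x'\<in>X. \<rho> (x' * y) = 0) \<and> x * y \<notin> span (S \<union> (\<lambda>x'. x' * y) ` X)"
        if X: "finite X" "X \<subseteq> N" and S: "finite S" and \<rho>: "functional \<rho>" for X S :: "'r set" and \<rho>
      proof -
        \<comment> \<open>\<open>V\<close> meets a finite-dimensional space containing all products
          \<open>x * y\<close> only in 0, so \<open>x * y \<in> V\<close> forces
          \<open>x * y = 0\<close>.\<close>
        have ann: "cofinite_dim {y. x * y = 0}" if xN: "x \<in> N" for x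
        proof -
          obtain F where F: "finite F" "\<forall>y. x * y \<in> span F"
            using xN unfolding N_def mem_Collect_eq by (elim exE conjE)
          obtain V where V: "cofinite_dim V" "V \<inter> span F = {0}"
            using cofinite_dim_avoids_span[OF F(1)] by blast
          have "cofinite_dim ((*) x -` V)"
            using V(1) by (rule cofinite_dim_vimage) (simp_all add: distrib_left scale_mult_right)
          moreover have "(*) x -` V \<subseteq> {y. x * y = 0}"
            using V(2) F(2) by blast
          ultimately show ?thesis
            by (rule cofinite_dim_mono)
        qed
        obtain V where V: "cofinite_dim V" "V \<inter> span S = {0}"
          using cofinite_dim_avoids_span[OF S] by blast
        \<comment> \<open>In an ideal within this set, a nonzero product \<open>x * y\<close> lies
          in \<open>V\<close> and hence outside \<open>span S\<close>, while all products
          \<open>x' * y\<close> with \<open>x' \<in> X\<close> are 0 and add nothing to the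
          span.\<close>
        have "cofinite_dim (N \<inter> V \<inter> (\<Inter>x\<in>X. {y. x * y = 0}))"
          using True V X ann by (intro cofinite_dim_Int cofinite_dim_INT) auto
        then obtain K where K: "two_sided_ideal K" "cofinite_dim K"
          "K \<subseteq> N \<inter> V \<inter> (\<Inter>x\<in>X. {y. x * y = 0})"
          using arens_regular_ideal_within[OF assms] by blast
        then obtain x y where xy: "x \<in> K" "y \<in> K" "x * y \<noteq> 0"
          using nonzero by blast
        then have "x * y \<in> V"
          using K unfolding two_sided_ideal_def by blast
        then have "x * y \<notin> span S"
          using V(2) xy(3) by blast
        moreover have X0: "x' * y = 0" if "x' \<in> X" for x'
          using K(3) xy(2) that by blast
        then have "span (S \<union> (\<lambda>x'. x' * y) ` X) \<subseteq> span S"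
          by (intro span_minimal) (auto simp: span_base span_zero)
        ultimately show ?thesis
          using X0 K(3) xy(1) \<rho> functional_0 by (metis IntD1 subsetD)
      qed
    qed
    then obtain \<rho> x y where \<rho>: "functional \<rho>" "\<forall>i :: nat. \<rho> (x i * y i) = 1"
      "\<forall>i j. i < j \<longrightarrow> \<rho> (x i * y j) = 0"
      by (elim exE conjE)
    show False
    proof (rule arens_regular_no_triangular_sequence[OF assms, where \<rho> = \<rho> and x = x and y = y
            and m = "(*)"])
      show "\<rho> \<in> dual"
        using \<rho>(1) by (simp only: dual_iff)
      show "\<rho> (x i * y i) = 1" for i
        using \<rho>(2) by (rule spec)
      show "\<rho> (x i * y j) = 0" if "i < j" for i j
        using \<rho>(3) that by iprover
    qed (rule disjI1, rule refl)
  qed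
qed

section \<open>From a square-zero ideal to Arens regularity\<close>

lemma bidual_add: "s \<in> bidual \<Longrightarrow> \<rho> \<in> dual \<Longrightarrow> \<sigma> \<in> dual \<Longrightarrow> s (\<lambda>x. \<rho> x + \<sigma> x) = s \<rho> + s \<sigma>"
  and bidual_scale: "s \<in> bidual \<Longrightarrow> \<rho> \<in> dual \<Longrightarrow> s (\<lambda>x. a * \<rho> x) = a * s \<rho>"
  by (simp_all add: bidual_def)

text \<open>Membership and value are proved together, as additivity of \<open>s\<close> is only
  available on \<open>dual\<close>.\<close>

lemma bidual_sum:
  assumes "s \<in> bidual" "finite I" "\<And>i. i \<in> I \<Longrightarrow> f i \<in> dual"
  shows "(\<lambda>x. \<Sum>i\<in>I. a i * f i x) \<in> dual \<and> s (\<lambda>x. \<Sum>i\<in>I. a i * f i x) = (\<Sum>i\<in>I. a i * s (f i))"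
  using assms(2,3)
proof (induction I rule: finite_induct)
  case empty
  have "(\<lambda>x. 0) \<in> dual"
    by (simp add: dual_iff functional_zero)
  with bidual_scale[OF assms(1) this, of 0] show ?case
    by simp
next
  case (insert i I)
  have "(\<lambda>x. a i * f i x) \<in> dual"
    using insert.prems by (simp add: dual_iff functional_iff algebra_simps)
  moreover have "s (\<lambda>x. a i * f i x) = a i * s (f i)"
    using assms(1) insert.prems by (intro bidual_scale) auto
  moreover have "(\<lambda>x. \<sigma> x + \<tau> x) \<in> dual \<and> s (\<lambda>x. \<sigma> x + \<tau> x) = s \<sigma> + s \<tau>"
    if "\<sigma> \<in> dual" "\<tau> \<in> dual" for \<sigma> \<tau>
    using bidual_add[OF assms(1) that] that by (simp add: dual_iff functional_iff algebra_simps)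
  ultimately show ?case
    using insert by simp
qed

text \<open>Both products evaluate to the sum of \<open>s (f i) * t (g i)\<close>, by commutativity
  of the field.\<close>

lemma arens_eq_if_finite_rank:
  assumes "s \<in> bidual" "t \<in> bidual" "\<rho> \<in> dual" "finite I"
    and fg: "\<And>i. i \<in> I \<Longrightarrow> f i \<in> dual \<and> g i \<in> dual"
    and \<rho>: "\<And>x y. \<rho> (x * y) = (\<Sum>i\<in>I. f i x * g i y)"
  shows "arens1 s t \<rho> = arens2 s t \<rho>"
proof -
  have f: "(\<lambda>x. \<Sum>i\<in>I. a i * f i x) \<in> dual" "s (\<lambda>x. \<Sum>i\<in>I. a i * f i x) = (\<Sum>i\<in>I. a i * s (f i))"
    and g: "(\<lambda>x. \<Sum>i\<in>I. a i * g i x) \<in> dual" "t (\<lambda>x. \<Sum>i\<in>I. a i * g i x) = (\<Sum>i\<in>I. a i * t (g i))"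
    for a
    using bidual_sum[of s I f a] bidual_sum[of t I g a] assms(1,2,4) fg by auto
  have "ract \<rho> r = (\<lambda>x. \<Sum>i\<in>I. f i r * g i x)" for r
    by (simp add: ract_def \<rho>)
  then have "lact2 t \<rho> = (\<lambda>r. \<Sum>i\<in>I. f i r * t (g i))"
    by (simp add: lact2_def g)
  also have "\<dots> = (\<lambda>r. \<Sum>i\<in>I. t (g i) * f i r)"
    by (simp add: mult.commute)
  finally have lact2: "lact2 t \<rho> = (\<lambda>r. \<Sum>i\<in>I. t (g i) * f i r)" .
  have "lact r \<rho> = (\<lambda>x. \<Sum>i\<in>I. g i r * f i x)" for r
    by (simp add: lact_def \<rho> mult.commute)
  then have "ract2 \<rho> s = (\<lambda>r. \<Sum>i\<in>I. g i r * s (f i))"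
    by (simp add: ract2_def f)
  also have "\<dots> = (\<lambda>r. \<Sum>i\<in>I. s (f i) * g i r)"
    by (simp add: mult.commute)
  finally have ract2: "ract2 \<rho> s = (\<lambda>r. \<Sum>i\<in>I. s (f i) * g i r)" .
  have "arens1 s t \<rho> = (\<Sum>i\<in>I. t (g i) * s (f i))" "arens2 s t \<rho> = (\<Sum>i\<in>I. s (f i) * t (g i))"
    using assms(3) by (simp_all add: arens1_def arens2_def lact2 ract2 f g)
  then show ?thesis
    by (simp add: mult.commute)
qed

text \<open>With \<open>p\<close> the part of \<open>x\<close> along a finite complement of
  \<open>J\<close>, expanding \<open>(x - p x) * (y - p y) = 0\<close> gives
  \<open>x * y = p x * y + (x - p x) * p y\<close>. Each summand has a factor in the span of
  \<open>C\<close>, so the form has finite rank.\<close>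

lemma arens_regular_if_square_zero_ideal:
  assumes J: "two_sided_ideal J" "\<And>x y. x \<in> J \<Longrightarrow> y \<in> J \<Longrightarrow> x * y = 0"
    and B: "finite B" "\<And>x. \<exists>b\<in>span B. x - b \<in> J"
  shows "arens_regular"
proof -
  have "subspace J"
    using J(1) by (simp add: two_sided_ideal_def)
  then obtain C c where C: "finite C" "\<And>b. functional (c b)"
    "\<And>x. x - (\<Sum>b\<in>C. scale (c b x) b) \<in> J"
    using finite_complement_coordinates[OF _ B] by blast
  define p where "p x = (\<Sum>b\<in>C. scale (c b x) b)" for x
  have p: "p (x + y) = p x + p y" "p (scale a x) = scale a (p x)" for x y a
    using C(2) by (simp_all add: p_def functional_add functional_scale scale_left_distrib
        sum.distrib scale_sum_right)
  have p_left: "p x * y = (\<Sum>b\<in>C. scale (c b x) (b * y))"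
    and p_right: "y * p x = (\<Sum>b\<in>C. scale (c b x) (y * b))" for x y
    by (simp_all add: p_def sum_distrib_left sum_distrib_right scale_mult_left scale_mult_right)
  have "arens1 s t \<rho> = arens2 s t \<rho>" if st: "s \<in> bidual" "t \<in> bidual" and \<rho>: "\<rho> \<in> dual" for s t \<rho>
  proof (rule arens_eq_if_finite_rank[OF st \<rho>])
    \<comment> \<open>The Boolean tag tells the two summands apart: \<open>True\<close> stands for
      \<open>p x * y\<close>, \<open>False\<close> for \<open>(x - p x) * p y\<close>.\<close>
    define f where "f = (\<lambda>(k, b). if k then c b else (\<lambda>x. \<rho> ((x - p x) * b)))"
    define g where "g = (\<lambda>(k, b). if k then (\<lambda>y. \<rho> (b * y)) else c b)"
    show "finite ((UNIV :: bool set) \<times> C)"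
      using C(1) by simp
    have "functional (\<lambda>x. \<rho> ((x - p x) * b))" "functional (\<lambda>y. \<rho> (b * y))" for b
      using \<rho> by (auto simp: dual_iff functional_iff functional_diff p algebra_simps scale_mult_left
          scale_mult_right)
    then show "f i \<in> dual \<and> g i \<in> dual" for i
      using C(2) by (auto simp: f_def g_def dual_iff split: prod.split)
    show "\<rho> (x * y) = (\<Sum>i\<in>UNIV \<times> C. f i x * g i y)" for x y
    proof -
      have "(x - p x) * (y - p y) = 0"
        using J(2) C(3) by (simp add: p_def)
      then have "x * y = p x * y + (x - p x) * p y"
        by (simp add: algebra_simps)
      also have "\<dots> = (\<Sum>b\<in>C. scale (c b x) (b * y)) + (\<Sum>b\<in>C. scale (c b y) ((x - p x) * b))"
        by (simp only: p_left p_right)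
      finally have "\<rho> (x * y) = (\<Sum>b\<in>C. c b x * \<rho> (b * y)) + (\<Sum>b\<in>C. c b y * \<rho> ((x - p x) * b))"
        using \<rho> by (simp add: dual_iff functional_add functional_sum functional_scale)
      also have "\<dots> = (\<Sum>i\<in>UNIV \<times> C. f i x * g i y)"
        by (simp add: f_def g_def UNIV_bool sum.cartesian_product' mult.commute)
      finally show ?thesis .
    qed
  qed
  \<comment> \<open>Outside \<open>dual\<close> both products are \<open>undefined\<close>, so
    agreement on \<open>dual\<close> suffices.\<close>
  then show ?thesis
    unfolding arens_regular_def
    by (auto simp: arens1_def arens2_def fun_eq_iff restrict_def split: if_splits)
qed

section \<open>Elementwise forms of finite codimension and square zero, and the equivalence\<close>

lemma finite_codimension_iff:
  assumes "subspace J"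
  shows "finite_codimension J \<longleftrightarrow> (\<exists>B. finite B \<and> (\<forall>x. \<exists>b\<in>span B. x - b \<in> J))"
proof -
  have "equiv UNIV (quot_rel J)"
  proof (rule equivI)
    show "refl (quot_rel J)"
      using assms by (auto simp: refl_on_def quot_rel_def subspace_0)
    show "sym (quot_rel J)"
      using subspace_neg[OF assms] by (force simp: sym_def quot_rel_def)
    show "trans (quot_rel J)"
      using subspace_add[OF assms] by (force simp: trans_def quot_rel_def)
  qed auto
  from eq_equiv_class_iff[OF this UNIV_I UNIV_I]
  have "quot_rel J `` {x} = quot_rel J `` {b} \<longleftrightarrow> (x, b) \<in> quot_rel J" for x b .
  then have "quot_rel J `` {x} = quot_rel J `` {b} \<longleftrightarrow> x - b \<in> J" for x b
    by (simp add: quot_rel_def)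
  moreover have "UNIV // quot_rel J = range (\<lambda>x. quot_rel J `` {x})"
    by (auto simp: quotient_def)
  moreover have "\<pi> ` S = range \<pi> \<longleftrightarrow> (\<forall>x. \<exists>b\<in>S. \<pi> x = \<pi> b)" for \<pi> :: "'r \<Rightarrow> 'r set" and S
    by (auto simp: image_iff set_eq_iff[of "\<pi> ` S"])
  ultimately have "(\<lambda>x. quot_rel J `` {x}) ` span B = UNIV // quot_rel J \<longleftrightarrow>
      (\<forall>x. \<exists>b\<in>span B. x - b \<in> J)" for B
    by (simp only:)
  then show ?thesis
    by (simp add: finite_codimension_def)
qed

lemma ideal_product_eq_0_iff:
  "ideal_product I J = {0} \<longleftrightarrow> (\<forall>x\<in>I. \<forall>y\<in>J. x * y = 0)"
proof
  assume *: "ideal_product I J = {0}"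
  have "x * y \<in> ideal_product I J" if "x \<in> I" "y \<in> J" for x y
    unfolding ideal_product_def by (rule span_base) (use that in blast)
  with * show "\<forall>x\<in>I. \<forall>y\<in>J. x * y = 0"
    by simp
next
  assume "\<forall>x\<in>I. \<forall>y\<in>J. x * y = 0"
  then have "{x * y |x y. x \<in> I \<and> y \<in> J} \<subseteq> {0}"
    by auto
  from span_minimal[OF this subspace_single_0] show "ideal_product I J = {0}"
    unfolding ideal_product_def by (rule antisym) (simp add: span_zero)
qed

lemma arens_regular_iff:
  "arens_regular \<longleftrightarrow>
    (\<exists>J. two_sided_ideal J \<and> finite_codimension J \<and> ideal_product J J = {0})"
proof
  assume "arens_regular"
  from arens_regular_square_zero_ideal[OF this]
  obtain J where J: "two_sided_ideal J" "cofinite_dim J" "\<forall>x\<in>J. \<forall>y\<in>J. x * y = 0"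
    by (elim exE conjE)
  have "\<exists>B. finite B \<and> (\<forall>x. \<exists>b\<in>span B. x - b \<in> J)"
    by (rule cofinite_dim_complement[OF J(2)]) auto
  then have "finite_codimension J"
    using J(1) by (simp add: finite_codimension_iff two_sided_ideal_def)
  with J show "\<exists>J. two_sided_ideal J \<and> finite_codimension J \<and> ideal_product J J = {0}"
    by (intro exI[of _ J]) (simp add: ideal_product_eq_0_iff)
next
  assume "\<exists>J. two_sided_ideal J \<and> finite_codimension J \<and> ideal_product J J = {0}"
  then obtain J where J: "two_sided_ideal J" "finite_codimension J" "ideal_product J J = {0}"
    by (elim exE conjE)
  then have "\<exists>B. finite B \<and> (\<forall>x. \<exists>b\<in>span B. x - b \<in> J)"
    by (simp add: finite_codimension_iff two_sided_ideal_def)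
  then obtain B where B: "finite B" "\<forall>x. \<exists>b\<in>span B. x - b \<in> J"
    by (elim exE conjE)
  show "arens_regular"
    by (rule arens_regular_if_square_zero_ideal[OF J(1) _ B(1)])
      (use J(3) B(2) in \<open>simp_all add: ideal_product_eq_0_iff\<close>)
qed

end

theorem theorem7p3:
  fixes scale :: "'f::field \<Rightarrow> 'r::ring_1 \<Rightarrow> 'r"
  assumes "unital_algebra scale"
    and "unital_algebra.infinite_dimensional scale"
  shows "unital_algebra.arens_regular scale \<longleftrightarrow>
    (\<exists>J. unital_algebra.two_sided_ideal scale J \<and>
         unital_algebra.finite_codimension scale J \<and>
         unital_algebra.ideal_product scale J J = {0})"
  using assms(1) by (rule unital_algebra.arens_regular_iff)

end
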